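(* Let $n,m\ge3$ be odd integers, $S$ and $T$ 2-partitions of $\mathbb{Z}_n^*$ and $\mathbb{Z}_m^*$ respectively, and $X_m$ a nucleus of order $m$. Then every $X$-generated product $W^X_{ST}$ is a 2-partition of $\mathbb{Z}_{mn}^*$.
   Context: $\mathbb{Z}_k^*=\mathbb{Z}_k\setminus\{0\}$; a 2-partition of $\mathbb{Z}_k^*$ is a partition into unordered pairs. A nucleus of order $m$ is a set of ordered pairs $X_m=\{(u_i,v_i)\}_{i=1}^{m-1}\subset\mathbb{Z}_m^*\times\mathbb{Z}_m^*$ such that $\{u_1,\dots,u_{m-1}\}=\{v_1,\dots,v_{m-1}\}=\mathbb{Z}_m^*$. $X$-generated product: with $n=2q+1$, $m=2p+1$, let $\tilde S$ (resp. $\tilde T$) be any set of ordered pairs obtained by ordering each pair of $S$ (resp. $T$) in either way. $W^X_{ST}$ consists of the unordered pairs $\{nr+x,\ nt+y\}$ (mod $nm$, with $x,y$ represented in $\{0,\dots,n-1\}$) of two types: (i$_X$) one pair for each $(x,y)\in\tilde S$ and each $(r,t)\in\{(0,0)\}\cup X_m$ ($mq$ pairs); (ii$_X$) one pair for each $(r,t)\in\tilde T$ with $x=y=0$ ($p$ pairs). *)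

theory Defs
  imports "HOL-Number_Theory.Residues" "HOL-Library.Disjoint_Sets"
begin

text \<open>
  The ring of integers modulo \<open>k\<close> is \<^const>\<open>residue_ring\<close>, whose carrier is the set of
  representatives \<open>{0..k - 1}\<close>.  Following the source, the star denotes the nonzero residues,
  not the units.
\<close>

definition Zstar :: "int \<Rightarrow> int set" where
  "Zstar k = carrier (residue_ring k) - {\<zero>\<^bsub>residue_ring k\<^esub>}"

definition two_partition :: "int \<Rightarrow> int set set \<Rightarrow> bool" where
  "two_partition k S \<longleftrightarrow> partition_on (Zstar k) S \<and> (\<forall>B\<in>S. card B = 2)"

definition nucleus :: "int \<Rightarrow> (int \<times> int) set \<Rightarrow> bool" where
  "nucleus m X \<longleftrightarrow> X \<subseteq> Zstar m \<times> Zstar m \<and> int (card X) = m - 1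
     \<and> fst ` X = Zstar m \<and> snd ` X = Zstar m"

text \<open>Each unordered pair in \<open>S\<close> is the underlying set of exactly one ordered pair in \<open>S'\<close>,
  and \<open>S'\<close> contains nothing else.\<close>

definition ordering_of :: "(int \<times> int) set \<Rightarrow> int set set \<Rightarrow> bool" where
  "ordering_of S' S \<longleftrightarrow> bij_betw (\<lambda>(x, y). {x, y}) S' S"

definition product_pair :: "int \<Rightarrow> int \<Rightarrow> int \<times> int \<Rightarrow> int \<times> int \<Rightarrow> int set" where
  "product_pair n m = (\<lambda>(r, t) (x, y). {(n * r + x) mod (n * m), (n * t + y) mod (n * m)})"

definition X_generated_product ::
  "int \<Rightarrow> int \<Rightarrow> int set set \<Rightarrow> int set set \<Rightarrow> (int \<times> int) set \<Rightarrow> int set set \<Rightarrow> bool" where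
  "X_generated_product n m S T X W \<longleftrightarrow>
     (\<exists>S' T'. ordering_of S' S \<and> ordering_of T' T \<and>
        W = {product_pair n m rt xy | rt xy. xy \<in> S' \<and> rt \<in> {(0, 0)} \<union> X}
          \<union> {product_pair n m rt (0, 0) | rt. rt \<in> T'})"

end

(* Division by n identifies the nonzero residues modulo n * m with the pairs (a, b) other than (0, 0),
   a being a residue modulo m and b a residue modulo n. If b is nonzero, it lies in exactly one
   pair of S, as first or as second entry of its ordering, and a is the first, respectively second,
   entry of exactly one element of X together with (0, 0). If b = 0, then a lies in exactly one pair
   of T. So every nonzero residue lies in exactly one pair of the product. *)

theory Submission imports Defs begin

lemma Zstar_eq: "Zstar k = {0<..<k}"
  by (auto simp: Zstar_def residue_ring_def)

text \<open>Disjointness is stated through a common element so that blocks can be compared via the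
  quotient and remainder of that element. Blocks are nonempty because they have two
  elements.\<close>

lemma two_partitionI:
  assumes "\<And>B. B \<in> P \<Longrightarrow> card B = 2" and "\<Union>P = Zstar k"
    and "\<And>B C z. B \<in> P \<Longrightarrow> C \<in> P \<Longrightarrow> z \<in> B \<Longrightarrow> z \<in> C \<Longrightarrow> B = C"
  shows "two_partition k P"
  unfolding two_partition_def
proof (intro conjI ballI partition_onI)
  show "{} \<notin> P" using assms(1) by fastforce
  show "disjnt p q" if "p \<in> P" "q \<in> P" "p \<noteq> q" for p q
    using assms(3) that unfolding disjnt_iff by blast
qed (use assms in auto)

context
  fixes k :: int and S :: "int set set" and S' :: "(int \<times> int) set"
  assumes S: "two_partition k S" and S': "ordering_of S' S"
begin

lemma ordering_in_partition: "(x, y) \<in> S' \<Longrightarrow> {x, y} \<in> S"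
  using S' by (auto simp: ordering_of_def bij_betw_def)

lemma ordering_entries:
  assumes "(x, y) \<in> S'"
  shows "x \<in> {0<..<k}" "y \<in> {0<..<k}" "x \<noteq> y"
proof -
  from ordering_in_partition[OF assms] have "{x, y} \<subseteq> Zstar k" "card {x, y} = 2"
    using S by (auto simp: two_partition_def partition_on_def)
  then show "x \<in> {0<..<k}" "y \<in> {0<..<k}" "x \<noteq> y"
    by (auto simp: Zstar_eq)
qed

lemma ordering_cover:
  assumes "z \<in> {0<..<k}"
  obtains x y where "(x, y) \<in> S'" "z \<in> {x, y}"
proof -
  have "z \<in> \<Union>S"
    using S assms by (simp add: two_partition_def partition_on_def Zstar_eq)
  then obtain B where B: "B \<in> S" "z \<in> B" by blast
  moreover have "S = (\<lambda>(x, y). {x, y}) ` S'"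
    using S' by (simp add: ordering_of_def bij_betw_def)
  ultimately obtain p where "p \<in> S'" "B = (\<lambda>(x, y). {x, y}) p" by blast
  with B that show thesis by (cases p) auto
qed

text \<open>Blocks of a partition that share \<open>z\<close> coincide as unordered pairs.
  Injectivity of the map that forgets the order then rules out that \<open>S'\<close> contains both
  orderings of one block.\<close>

lemma ordering_unique:
  assumes "(x, y) \<in> S'" "(u, v) \<in> S'" "z \<in> {x, y}" "z \<in> {u, v}"
  shows "x = u \<and> y = v"
proof -
  have "{x, y} = {u, v}"
  proof (rule ccontr)
    assume "{x, y} \<noteq> {u, v}"
    then have "{x, y} \<inter> {u, v} = {}"
      using S ordering_in_partition[OF assms(1)] ordering_in_partition[OF assms(2)]
      unfolding two_partition_def partition_on_def by (meson disjointD)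
    with assms(3,4) show False by blast
  qed
  moreover have "inj_on (\<lambda>(x, y). {x, y}) S'"
    using S' by (simp add: ordering_of_def bij_betw_def)
  ultimately have "(x, y) = (u, v)"
    using assms(1,2) by (auto dest!: inj_onD[of _ S' "(x, y)" "(u, v)"])
  then show ?thesis by simp
qed

end

text \<open>Each projection maps the \<open>m - 1\<close> elements of \<open>X\<close> onto a set of
  size \<open>m - 1\<close>, hence is injective there. The added pair \<open>(0, 0)\<close> supplies
  the one missing residue.\<close>

lemma nucleus_bij_betw:
  assumes "nucleus m X" "m > 1"
  shows "bij_betw fst (insert (0, 0) X) {0..<m}" "bij_betw snd (insert (0, 0) X) {0..<m}"
proof -
  have card: "int (card X) = m - 1" and img: "fst ` X = {0<..<m}" "snd ` X = {0<..<m}"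
    using assms by (auto simp: nucleus_def Zstar_eq)
  \<comment> \<open>An infinite set has \<open>card\<close> equal to 0, whereas \<open>m - 1\<close>
    is positive.\<close>
  then have "finite X"
    using assms(2) by (intro card_ge_0_finite) linarith
  moreover have "card X = card {0<..<m}"
    using card by simp
  ultimately have "inj_on fst X" "inj_on snd X"
    using img by (auto intro!: eq_card_imp_inj_on)
  moreover have "(0, 0) \<notin> X" "0 \<notin> fst ` X" "0 \<notin> snd ` X"
    unfolding img using img by force+
  moreover have "insert 0 {0<..<m} = {0..<m}"
    using assms(2) by auto
  ultimately show "bij_betw fst (insert (0, 0) X) {0..<m}" "bij_betw snd (insert (0, 0) X) {0..<m}"
    using img by (auto simp: bij_betw_def)
qed

text \<open>The entries are already reduced modulo \<open>n * m\<close>, since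
  \<open>n * a + b < n * (a + 1) \<le> n * m\<close>.\<close>

lemma product_pair_eq:
  fixes n m :: int
  assumes "r \<in> {0..<m}" "t \<in> {0..<m}" "x \<in> {0..<n}" "y \<in> {0..<n}"
  shows "product_pair n m (r, t) (x, y) = {n * r + x, n * t + y}"
proof -
  have "(n * a + b) mod (n * m) = n * a + b" if "a \<in> {0..<m}" "b \<in> {0..<n}" for a b
  proof -
    have "n * (a + 1) \<le> n * m"
      using that by (intro mult_left_mono) auto
    then have "n * a + b < n * m"
      using that by (simp add: algebra_simps)
    then show ?thesis
      using that by simp
  qed
  then show ?thesis
    using assms by (simp add: product_pair_def)
qed

text \<open>By uniqueness of division with remainder, membership becomes a statement about
  coordinates; the main proof uses it to find the index of a block from an element.\<close>

lemma mem_product_pair_iff: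
  fixes n m :: int
  assumes "r \<in> {0..<m}" "t \<in> {0..<m}" "x \<in> {0..<n}" "y \<in> {0..<n}"
  shows "z \<in> product_pair n m (r, t) (x, y) \<longleftrightarrow>
    z div n = r \<and> z mod n = x \<or> z div n = t \<and> z mod n = y"
proof -
  have "z = n * a + b \<longleftrightarrow> z div n = a \<and> z mod n = b" if "b \<in> {0..<n}" for a b
    using that by auto
  then show ?thesis
    using assms by (simp add: product_pair_eq)
qed

lemma div_mod_nonneg_less_iff:
  fixes n m z :: int
  assumes "n > 0"
  shows "z \<in> {0<..<n * m} \<longleftrightarrow> z div n \<in> {0..<m} \<and> (z div n \<noteq> 0 \<or> z mod n \<noteq> 0)"
proof -
  have "0 \<le> z \<longleftrightarrow> 0 \<le> z div n"
    using assms by (simp add: pos_imp_zdiv_nonneg_iff)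
  moreover have "z < n * m \<longleftrightarrow> z div n < m"
    \<comment> \<open>Subtracting \<open>n * m\<close> from \<open>z\<close> lowers the quotient by
      \<open>m\<close>, so both inequalities become sign conditions.\<close>
    using assms pos_imp_zdiv_neg_iff[of n "z + n * (- m)"] by (simp only: div_mult_self2) simp
  moreover have "z = 0 \<longleftrightarrow> z div n = 0 \<and> z mod n = 0"
    by (metis div_0 mod_0 mult_div_mod_eq mult_zero_right add_0)
  ultimately show ?thesis by auto
qed

theorem theorem3p15:
  fixes n m :: int and S T W :: "int set set" and X :: "(int \<times> int) set"
  assumes "n \<ge> 3" and "odd n" and "m \<ge> 3" and "odd m"
    and "two_partition n S" and "two_partition m T"
    and "nucleus m X"
    and "X_generated_product n m S T X W"
  shows "two_partition (m * n) W"
proof -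
  from assms(8) obtain S' T' where S': "ordering_of S' S" and T': "ordering_of T' T"
    and W: "W = {product_pair n m rt xy | rt xy. xy \<in> S' \<and> rt \<in> {(0, 0)} \<union> X}
          \<union> {product_pair n m rt (0, 0) | rt. rt \<in> T'}"
    by (auto simp: X_generated_product_def)
  define Y where "Y = insert (0, 0) X"
  \<comment> \<open>Both types of pairs are indexed by quadruples \<open>r t x y\<close>, so that
    each goal below can treat them together.\<close>
  have W_iff: "B \<in> W \<longleftrightarrow> (\<exists>r t x y. ((r, t) \<in> Y \<and> (x, y) \<in> S' \<or> (r, t) \<in> T' \<and> x = 0 \<and> y = 0)
      \<and> B = product_pair n m (r, t) (x, y))" for B
    unfolding W Y_def by fast
  note Sent = ordering_entries[OF assms(5) S'] and Tent = ordering_entries[OF assms(6) T']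
  have bij: "bij_betw fst Y {0..<m}" "bij_betw snd Y {0..<m}"
    using nucleus_bij_betw[OF assms(7)] assms(3) by (auto simp: Y_def)
  have Yent: "r \<in> {0..<m}" "t \<in> {0..<m}" if "(r, t) \<in> Y" for r t
    using bij that by (force simp: bij_betw_def)+
  \<comment> \<open>The disjunctions say that the two entries of a block differ and that neither is
    0. For the first type \<open>x\<close> and \<open>y\<close> witness this, for the second
    \<open>r\<close> and \<open>t\<close>.\<close>
  have range: "r \<in> {0..<m} \<and> t \<in> {0..<m} \<and> x \<in> {0..<n} \<and> y \<in> {0..<n} \<and> (r \<noteq> t \<or> x \<noteq> y)
      \<and> (r \<noteq> 0 \<or> x \<noteq> 0) \<and> (t \<noteq> 0 \<or> y \<noteq> 0)"
    if "(r, t) \<in> Y \<and> (x, y) \<in> S' \<or> (r, t) \<in> T' \<and> x = 0 \<and> y = 0" for r t x y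
    using that assms(1) Sent[of x y] Tent[of r t] Yent[of r t] by auto
  note mem = mem_product_pair_iff[where n = n and m = m]
  have Zmn: "Zstar (m * n) = {0<..<n * m}"
    by (simp add: Zstar_eq mult.commute)
  note Zn = div_mod_nonneg_less_iff[of n _ m]
  show ?thesis
  proof (rule two_partitionI)
    fix B assume "B \<in> W"
    then obtain r t x y where idx: "(r, t) \<in> Y \<and> (x, y) \<in> S' \<or> (r, t) \<in> T' \<and> x = 0 \<and> y = 0"
      and B: "B = product_pair n m (r, t) (x, y)"
      unfolding W_iff by blast
    have *: "(n * a + b) div n = a" "(n * a + b) mod n = b" if "b \<in> {0..<n}" for a b
      using that by auto
    from range[OF idx] have "n * r + x \<noteq> n * t + y"
      using *[of x r] *[of y t] by metis
    with range[OF idx] show "card B = 2"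
      by (simp add: B product_pair_eq)
  next
    show "\<Union>W = Zstar (m * n)"
    proof (intro equalityI subsetI)
      fix z assume "z \<in> \<Union>W"
      then obtain B where "B \<in> W" "z \<in> B" by blast
      then obtain r t x y where idx: "(r, t) \<in> Y \<and> (x, y) \<in> S' \<or> (r, t) \<in> T' \<and> x = 0 \<and> y = 0"
        and "z \<in> product_pair n m (r, t) (x, y)"
        unfolding W_iff by blast
      then have "z div n = r \<and> z mod n = x \<or> z div n = t \<and> z mod n = y"
        using range[OF idx] by (simp add: mem)
      then show "z \<in> Zstar (m * n)"
        unfolding Zmn using range[OF idx] assms(1) Zn[of z] by auto
    next
      fix z assume "z \<in> Zstar (m * n)"
      then have z: "z div n \<in> {0..<m}" "z div n \<noteq> 0 \<or> z mod n \<noteq> 0"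
        unfolding Zmn using assms(1) Zn[of z] by auto
      have "\<exists>r t x y. ((r, t) \<in> Y \<and> (x, y) \<in> S' \<or> (r, t) \<in> T' \<and> x = 0 \<and> y = 0)
          \<and> (z div n = r \<and> z mod n = x \<or> z div n = t \<and> z mod n = y)"
      proof (cases "z mod n = 0")
        case True
        with z have "z div n \<in> {0<..<m}" by auto
        then obtain r t where "(r, t) \<in> T'" "z div n = r \<or> z div n = t"
          using ordering_cover[OF assms(6) T'] by (metis insertE singletonD)
        with True show ?thesis by metis
      next
        case False
        then have "z mod n \<in> {0<..<n}"
          using assms(1) pos_mod_bound[of n z] pos_mod_sign[of n z]
          unfolding greaterThanLessThan_iff by linarith
        then obtain x y where xy: "(x, y) \<in> S'" "z mod n \<in> {x, y}"
          by (rule ordering_cover[OF assms(5) S'])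
        have "z div n \<in> fst ` Y" "z div n \<in> snd ` Y"
          using z bij by (auto simp: bij_betw_def)
        \<comment> \<open>Two elements of \<open>Y\<close> are kept: the first serves if
          \<open>z mod n\<close> is \<open>x\<close>, the second if it is \<open>y\<close>.\<close>
        then obtain r t where "(z div n, t) \<in> Y" "(r, z div n) \<in> Y" by force
        with xy show ?thesis by (metis insertE singletonD)
      qed
      then obtain r t x y where idx: "(r, t) \<in> Y \<and> (x, y) \<in> S' \<or> (r, t) \<in> T' \<and> x = 0 \<and> y = 0"
        and "z div n = r \<and> z mod n = x \<or> z div n = t \<and> z mod n = y"
        by metis
      then have "z \<in> product_pair n m (r, t) (x, y)"
        using range[OF idx] by (simp add: mem)
      moreover have "product_pair n m (r, t) (x, y) \<in> W"
        using idx unfolding W_iff by blast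
      ultimately show "z \<in> \<Union>W" by blast
    qed
  next
    fix B C z assume BC: "B \<in> W" "C \<in> W" "z \<in> B" "z \<in> C"
    obtain r t x y where idx: "(r, t) \<in> Y \<and> (x, y) \<in> S' \<or> (r, t) \<in> T' \<and> x = 0 \<and> y = 0"
      and B: "B = product_pair n m (r, t) (x, y)"
      using BC(1) unfolding W_iff by blast
    obtain r' t' x' y' where
      idx': "(r', t') \<in> Y \<and> (x', y') \<in> S' \<or> (r', t') \<in> T' \<and> x' = 0 \<and> y' = 0"
      and C: "C = product_pair n m (r', t') (x', y')"
      using BC(2) unfolding W_iff by blast
    have z: "z div n = r \<and> z mod n = x \<or> z div n = t \<and> z mod n = y"
      using BC(3) range[OF idx] by (simp add: B mem)
    have z': "z div n = r' \<and> z mod n = x' \<or> z div n = t' \<and> z mod n = y'"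
      using BC(4) range[OF idx'] by (simp add: C mem)
    have "r = r' \<and> t = t' \<and> x = x' \<and> y = y'"
    proof (cases "z mod n = 0")
      case True
      \<comment> \<open>Remainder 0 excludes the first type, because entries of \<open>S'\<close>
        are nonzero.\<close>
      then have "(r, t) \<in> T'" "(r', t') \<in> T'" "x = 0" "y = 0" "x' = 0" "y' = 0"
        using idx idx' z z' Sent[of x y] Sent[of x' y'] by auto
      then show ?thesis
        using ordering_unique[OF assms(6) T', of r t r' t' "z div n"] z z' by auto
    next
      case False
      then have mems: "(r, t) \<in> Y" "(x, y) \<in> S'" "(r', t') \<in> Y" "(x', y') \<in> S'"
        using idx idx' z z' by auto
      then have xy: "x = x'" "y = y'"
        using ordering_unique[OF assms(5) S', of x y x' y' "z mod n"] z z' by auto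
      \<comment> \<open>Since \<open>x \<noteq> y\<close>, the remainder of \<open>z\<close> decides
        whether \<open>z\<close> is the first or the second entry, and decides it alike for
        \<open>B\<close> and \<open>C\<close>. The quotients agree in that position, and injectivity
        of the corresponding projection on \<open>Y\<close> gives the rest.\<close>
      with mems z z' have "r = r' \<or> t = t'"
        using Sent(3)[of x y] by auto
      then have "(r, t) = (r', t')"
        using mems inj_onD[OF bij_betw_imp_inj_on[OF bij(1)], of "(r, t)" "(r', t')"]
          inj_onD[OF bij_betw_imp_inj_on[OF bij(2)], of "(r, t)" "(r', t')"] by auto
      with xy show ?thesis by simp
    qed
    then show "B = C" by (simp add: B C)
  qed
qed

end
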